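(* Let $\mathcal I,\mathcal J$ be ideals on $\omega$ and let $\mathcal F\subseteq\omega^\omega$. If $\mathfrak{fip}(\mathcal I,\mathcal J,\mathcal F)\ge|\mathcal F|$, then there exists an ultrafilter $\mathcal U$ on $\omega$ such that $\mathcal I\not\le_{\mathcal F}\mathcal U^*$ and $\mathcal J\subseteq\mathcal U^*$. In particular, if (under this assumption) $\mathcal F=\omega^\omega$ ($\mathcal F$ is the family of all finite-to-one functions, or $\mathcal F$ is the family of all one-to-one functions $\omega\to\omega$, respectively), then there exists an $\mathcal I$-ultrafilter (a weak $\mathcal I$-ultrafilter, or an $\mathcal I$-point, respectively) which is not a $\mathcal J$-point.
   Context: An ideal on $\omega$ is a family of subsets of $\omega$ closed under finite unions and subsets, containing all finite sets and not containing $\omega$; $\mathcal J^+=\mathcal P(\omega)\setminus\mathcal J$. Ultrafilters on $\omega$ contain all cofinite sets; $\mathcal U^*=\{\omega\setminus A:A\in\mathcal U\}$ is the dual ideal. For $\mathcal F\subseteq\omega^\omega$ and ideals $\mathcal I,\mathcal K$ on $\omega$, $\mathcal I\le_{\mathcal F}\mathcal K$ means that there is $f\in\mathcal F$ with $f^{-1}[B]\in\mathcal K$ for every $B\in\mathcal I$. A nonempty family $\mathcal A\subseteq\mathcal P(\omega)$ has $\mathcal J^+$-FIP if $\bigcap F\in\mathcal J^+$ for each finite $F\subseteq\mathcal A$. With $\mathfrak c=2^{\aleph_0}$ and $\mathfrak c^+$ its successor cardinal, $\mathfrak{fip}(\mathcal I,\mathcal J,\mathcal F)$ is the minimum of the set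 consisting of $\mathfrak c^+$ and all cardinals $|\mathcal A|$ such that $\mathcal A$ has $\mathcal J^+$-FIP (so $\mathcal A$ is a nonempty family of subsets of $\omega$) and it is not true that for every $f\in\mathcal F$ there is $B\in\mathcal I$ such that $\mathcal A\cup\{f^{-1}[B]\}$ has $\mathcal J^+$-FIP. An ultrafilter $\mathcal U$ on $\omega$ is an $\mathcal I$-ultrafilter (weak $\mathcal I$-ultrafilter, $\mathcal I$-point, respectively) if $\mathcal I\not\le_{\mathcal F}\mathcal U^*$ where $\mathcal F$ is the family of all (all finite-to-one, all one-to-one, respectively) functions $\omega\to\omega$; a $\mathcal J$-point is defined in the same way with $\mathcal J$ in place of $\mathcal I$. A function is finite-to-one if preimages of points are finite.
   Formalization: When F has exactly one element, the inequality fip(I,J,F) ≥ |F| is assumed to be strict; without this the claim fails, e.g. for I = J = the finite sets and F = {id}, where fip = 1 = |F|. *)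

theory Defs
  imports Main
begin

unbundle cardinal_syntax

definition ideal_on_omega :: "nat set set \<Rightarrow> bool" where
  "ideal_on_omega I \<longleftrightarrow>
     (\<forall>A\<in>I. \<forall>B\<in>I. A \<union> B \<in> I) \<and>
     (\<forall>A\<in>I. \<forall>B. B \<subseteq> A \<longrightarrow> B \<in> I) \<and>
     (\<forall>A. finite A \<longrightarrow> A \<in> I) \<and>
     UNIV \<notin> I"

definition positive_sets :: "nat set set \<Rightarrow> nat set set" where
  "positive_sets J = - J"

definition ultrafilter_on_omega :: "nat set set \<Rightarrow> bool" where
  "ultrafilter_on_omega U \<longleftrightarrow>
     {} \<notin> U \<and>
     (\<forall>A\<in>U. \<forall>B\<in>U. A \<inter> B \<in> U) \<and>
     (\<forall>A\<in>U. \<forall>B. A \<subseteq> B \<longrightarrow> B \<in> U) \<and>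
     (\<forall>A. A \<in> U \<or> - A \<in> U) \<and>
     (\<forall>A. finite (- A) \<longrightarrow> A \<in> U)"

definition dual_ideal :: "nat set set \<Rightarrow> nat set set" where
  "dual_ideal U = {- A | A. A \<in> U}"

definition ideal_le :: "(nat \<Rightarrow> nat) set \<Rightarrow> nat set set \<Rightarrow> nat set set \<Rightarrow> bool" where
  "ideal_le F I K \<longleftrightarrow> (\<exists>f\<in>F. \<forall>B\<in>I. f -` B \<in> K)"

text \<open>The empty subfamily contributes \<open>\<Inter>{} = UNIV\<close>, which is positive for every ideal.\<close>

definition positive_FIP :: "nat set set \<Rightarrow> nat set set \<Rightarrow> bool" where
  "positive_FIP J \<A> \<longleftrightarrow>
     \<A> \<noteq> {} \<and> (\<forall>G. finite G \<and> G \<subseteq> \<A> \<longrightarrow> \<Inter>G \<in> positive_sets J)"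

text \<open>
  Cardinals are represented by cardinal orders, considered up to \<open>=o\<close>. The set whose
  minimum is taken has to live in one type: \<open>\<cc>\<close> is the cardinal of \<open>nat set\<close>, so its
  library successor is an order on \<open>nat set set\<close>, and the cardinal of \<open>\<A> :: nat set set\<close>
  is therefore transported to that type along the injection \<open>A \<mapsto> {A}\<close>.
\<close>

definition continuum_succ :: "nat set set rel" where
  "continuum_succ = cardSuc |UNIV :: nat set set|"

definition fip_cardinals ::
    "nat set set \<Rightarrow> nat set set \<Rightarrow> (nat \<Rightarrow> nat) set \<Rightarrow> nat set set rel set" where
  "fip_cardinals I J F =
     insert continuum_succ
       {|(\<lambda>A. {A}) ` \<A>| | \<A>.
          positive_FIP J \<A> \<and>
          \<not> (\<forall>f\<in>F. \<exists>B\<in>I. positive_FIP J (\<A> \<union> {f -` B}))}"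

text \<open>A minimum exists because any nonempty set of well-orders has one, and it is unique
  up to \<open>=o\<close>.\<close>

definition fip ::
    "nat set set \<Rightarrow> nat set set \<Rightarrow> (nat \<Rightarrow> nat) set \<Rightarrow> nat set set rel" where
  "fip I J F =
     (SOME r. r \<in> fip_cardinals I J F \<and> (\<forall>s\<in>fip_cardinals I J F. r \<le>o s))"

text \<open>
  The inequality \<open>|F| \<le>o fip I J F\<close> alone does not suffice when \<open>F\<close> has exactly one element.
  If \<open>I\<close> and \<open>J\<close> both consist of the finite sets and \<open>F = {id}\<close>, then the family \<open>{UNIV}\<close>
  shows that \<open>fip I J F\<close> is \<open>1\<close>, which equals the cardinal of \<open>F\<close>; yet no ultrafilter \<open>U\<close>
  satisfies \<open>\<not> ideal_le F I (dual_ideal U)\<close>, since every dual ideal contains all finite sets.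
  The inequality therefore has to be strict for a one-element \<open>F\<close>.
\<close>

definition finite_to_one :: "(nat \<Rightarrow> nat) \<Rightarrow> bool" where
  "finite_to_one f \<longleftrightarrow> (\<forall>n. finite (f -` {n}))"

definition I_ultrafilter :: "nat set set \<Rightarrow> nat set set \<Rightarrow> bool" where
  "I_ultrafilter I U \<longleftrightarrow> ultrafilter_on_omega U \<and> \<not> ideal_le UNIV I (dual_ideal U)"

definition weak_I_ultrafilter :: "nat set set \<Rightarrow> nat set set \<Rightarrow> bool" where
  "weak_I_ultrafilter I U \<longleftrightarrow>
     ultrafilter_on_omega U \<and> \<not> ideal_le {f. finite_to_one f} I (dual_ideal U)"

definition I_point :: "nat set set \<Rightarrow> nat set set \<Rightarrow> bool" where
  "I_point I U \<longleftrightarrow> ultrafilter_on_omega U \<and> \<not> ideal_le {f. inj f} I (dual_ideal U)"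

end

theory Submission
  imports Defs
begin

text \<open>
  The ultrafilter arises by transfinite recursion along the cardinal order \<open>|F|\<close>. For each
  \<open>f \<in> F\<close> one chooses a set \<open>B f \<in> I\<close> such that the family of all preimages
  \<open>h -` B h\<close>, with \<open>h\<close> up to and including \<open>f\<close>, keeps \<open>J\<^sup>+\<close>-FIP. The choice is possible because
  the predecessors of \<open>f\<close> are fewer than \<open>|F|\<close>, hence fewer than \<open>fip I J F\<close>, and below that
  cardinal every family with \<open>J\<^sup>+\<close>-FIP can be extended by some preimage under any
  member of \<open>F\<close> (\<open>positive_FIP_extend_below_fip\<close>). Since \<open>J\<^sup>+\<close>-FIP only concerns finite
  subfamilies, it survives at limit stages, and the whole family of preimages
  has it (\<open>exists_positive_preimages\<close>).

  A family that is maximal with respect to \<open>J\<^sup>+\<close>-FIP is an ultrafilter, and it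
  contains the complement of every member of \<open>J\<close>, because removing a member of \<open>J\<close> from a positive
  set leaves a positive set (\<open>exists_ultrafilter_extending\<close>). An ultrafilter \<open>U\<close> containing
  all the sets \<open>f -` B f\<close> satisfies \<open>\<not> ideal_le F I (dual_ideal U)\<close>. If also
  \<open>J \<subseteq> dual_ideal U\<close>, then the identity shows that \<open>U\<close> is not a \<open>J\<close>-point.
\<close>

section \<open>Families with the positive finite intersection property\<close>

lemma positive_FIP_Inter:
  assumes "positive_FIP J \<A>" and "finite G" and "G \<subseteq> \<A>"
  shows "\<Inter>G \<notin> J"
  using assms by (auto simp: positive_FIP_def positive_sets_def)

lemma positive_FIP_insert_iff:
  "positive_FIP J (insert A \<A>) \<longleftrightarrow>
     (\<forall>G. finite G \<and> G \<subseteq> \<A> \<longrightarrow> \<Inter>G \<notin> J \<and> A \<inter> \<Inter>G \<notin> J)" (is "?L \<longleftrightarrow> ?R")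
proof
  assume L: ?L
  show ?R
  proof (intro allI impI, elim conjE)
    fix G assume "finite G" "G \<subseteq> \<A>"
    then show "\<Inter>G \<notin> J \<and> A \<inter> \<Inter>G \<notin> J"
      using positive_FIP_Inter[OF L, of G] positive_FIP_Inter[OF L, of "insert A G"] by auto
  qed
next
  assume R: ?R
  have "\<Inter>G \<notin> J" if G: "finite G" "G \<subseteq> insert A \<A>" for G
  proof (cases "A \<in> G")
    case True
    then have "\<Inter>G = A \<inter> \<Inter>(G - {A})" by auto
    then show ?thesis using R G by (metis finite_Diff subset_insert_iff)
  next
    case False
    then show ?thesis using R G by (metis subset_insert)
  qed
  then show ?L by (auto simp: positive_FIP_def positive_sets_def)
qed

text \<open>\<open>J\<^sup>+\<close>-FIP has finite character; this carries it through limit stages and unions of chains.\<close>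

lemma positive_FIP_finitary:
  assumes "\<A> \<noteq> {}"
    and "\<And>G. finite G \<Longrightarrow> G \<subseteq> \<A> \<Longrightarrow> \<exists>\<D>. positive_FIP J \<D> \<and> G \<subseteq> \<D>"
  shows "positive_FIP J \<A>"
  unfolding positive_FIP_def positive_sets_def
  using assms positive_FIP_Inter by (metis ComplI)

lemma positive_FIP_singleton_UNIV:
  assumes "ideal_on_omega J"
  shows "positive_FIP J {UNIV}"
  using assms by (simp add: positive_FIP_insert_iff ideal_on_omega_def)

section \<open>Ultrafilters from maximal families\<close>

lemma exists_maximal_positive_FIP:
  assumes "positive_FIP J \<A>"
  obtains U where "\<A> \<subseteq> U" and "positive_FIP J U"
    and "\<And>A. positive_FIP J (insert A U) \<Longrightarrow> A \<in> U"
proof -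
  let ?Z = "{V. \<A> \<subseteq> V \<and> positive_FIP J V}"
  have "\<exists>M\<in>?Z. \<forall>X\<in>?Z. M \<subseteq> X \<longrightarrow> X = M"
  proof (rule subset_Zorn_nonempty)
    show "?Z \<noteq> {}" using assms by blast
    fix \<C> assume ne: "\<C> \<noteq> {}" and chain: "subset.chain ?Z \<C>"
    have sub: "\<C> \<subseteq> ?Z" using chain by (auto simp: subset.chain_def)
    have "positive_FIP J (\<Union>\<C>)"
    proof (rule positive_FIP_finitary)
      have "\<A> \<noteq> {}" using assms by (simp add: positive_FIP_def)
      then show "\<Union>\<C> \<noteq> {}" using ne sub by blast
      fix G assume "finite G" "G \<subseteq> \<Union>\<C>"
      then obtain D where "D \<in> \<C>" "G \<subseteq> D"
        using finite_subset_Union_chain ne chain by metis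
      then show "\<exists>\<D>. positive_FIP J \<D> \<and> G \<subseteq> \<D>" using sub by blast
    qed
    then show "\<Union>\<C> \<in> ?Z" using ne sub by blast
  qed
  then obtain M where "M \<in> ?Z" and max: "\<forall>X\<in>?Z. M \<subseteq> X \<longrightarrow> X = M" ..
  then have M: "\<A> \<subseteq> M" "positive_FIP J M" by simp_all
  have "A \<in> M" if "positive_FIP J (insert A M)" for A
    using bspec[OF max, of "insert A M"] M(1) that by auto
  with M show ?thesis using that by blast
qed

lemma exists_ultrafilter_extending:
  assumes J: "ideal_on_omega J" and \<A>: "positive_FIP J \<A>"
  obtains U where "ultrafilter_on_omega U" and "\<A> \<subseteq> U" and "J \<subseteq> dual_ideal U"
proof -
  have J_un: "\<And>A B. A \<in> J \<Longrightarrow> B \<in> J \<Longrightarrow> A \<union> B \<in> J"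
    and J_sub: "\<And>A B. A \<in> J \<Longrightarrow> B \<subseteq> A \<Longrightarrow> B \<in> J"
    and J_fin: "\<And>A. finite A \<Longrightarrow> A \<in> J"
    using J unfolding ideal_on_omega_def by blast+
  obtain U where sub: "\<A> \<subseteq> U" and FIP: "positive_FIP J U"
    and max: "\<And>A. positive_FIP J (insert A U) \<Longrightarrow> A \<in> U"
    using exists_maximal_positive_FIP[OF \<A>] by metis
  have Int_pos: "\<Inter>G \<notin> J" if "finite G" "G \<subseteq> U" for G
    using positive_FIP_Inter[OF FIP that] .
  have notin: "\<exists>G. finite G \<and> G \<subseteq> U \<and> A \<inter> \<Inter>G \<in> J" if "A \<notin> U" for A
    using max[of A] that Int_pos by (auto simp: positive_FIP_insert_iff)
  have co: "- A \<in> U" if "A \<in> J" for A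
  proof (rule ccontr)
    assume "- A \<notin> U"
    then obtain G where G: "finite G" "G \<subseteq> U" "- A \<inter> \<Inter>G \<in> J" using notin by blast
    have "\<Inter>G \<in> J" using J_sub[OF J_un[OF \<open>A \<in> J\<close> G(3)]] by blast
    then show False using Int_pos G by blast
  qed
  have closed: "A \<in> U" if "finite H" "H \<subseteq> U" "\<Inter>H \<subseteq> A" for A H
  proof (rule ccontr)
    assume "A \<notin> U"
    then obtain G where G: "finite G" "G \<subseteq> U" "A \<inter> \<Inter>G \<in> J" using notin by blast
    have "\<Inter>(H \<union> G) \<subseteq> A \<inter> \<Inter>G" using that by blast
    then have "\<Inter>(H \<union> G) \<in> J" using J_sub[OF G(3)] by blast
    then show False using Int_pos[of "H \<union> G"] G that by blast
  qed
  have ultra: "A \<in> U \<or> - A \<in> U" for A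
  proof (rule ccontr)
    assume "\<not> ?thesis"
    then obtain G H where G: "finite G" "G \<subseteq> U" "A \<inter> \<Inter>G \<in> J"
      and H: "finite H" "H \<subseteq> U" "- A \<inter> \<Inter>H \<in> J" using notin by metis
    have "\<Inter>(G \<union> H) \<subseteq> (A \<inter> \<Inter>G) \<union> (- A \<inter> \<Inter>H)" by blast
    then have "\<Inter>(G \<union> H) \<in> J" using J_sub[OF J_un[OF G(3) H(3)]] by blast
    then show False using Int_pos[of "G \<union> H"] G H by blast
  qed
  have "ultrafilter_on_omega U"
    unfolding ultrafilter_on_omega_def
  proof (intro conjI ballI allI impI)
    show "{} \<notin> U" using Int_pos[of "{{}}"] J_fin by auto
    show "A \<inter> B \<in> U" if "A \<in> U" "B \<in> U" for A B using closed[of "{A, B}"] that by auto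
    show "B \<in> U" if "A \<in> U" "A \<subseteq> B" for A B using closed[of "{A}"] that by auto
    show "A \<in> U \<or> - A \<in> U" for A by (rule ultra)
    show "A \<in> U" if "finite (- A)" for A using co[OF J_fin[OF that]] by simp
  qed
  moreover have "J \<subseteq> dual_ideal U"
  proof
    fix A assume "A \<in> J"
    then have "A = - (- A) \<and> - A \<in> U" using co by simp
    then show "A \<in> dual_ideal U" unfolding dual_ideal_def by blast
  qed
  ultimately show ?thesis using sub by (intro that)
qed

section \<open>Extending families smaller than the cardinal invariant\<close>

lemma fip_lower_bound:
  assumes "s \<in> fip_cardinals I J F"
  shows "fip I J F \<le>o s"
proof -
  have "Well_order r" if "r \<in> fip_cardinals I J F" for r
    using that cardSuc_Card_order[OF card_of_Card_order, of "UNIV :: nat set set"]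
    by (auto simp: fip_cardinals_def continuum_succ_def card_order_on_def card_of_Well_order)
  then have "\<exists>r\<in>fip_cardinals I J F. \<forall>s\<in>fip_cardinals I J F. r \<le>o s"
    using exists_minim_Well_order[of "fip_cardinals I J F"] assms by blast
  then have "\<exists>r. r \<in> fip_cardinals I J F \<and> (\<forall>s\<in>fip_cardinals I J F. r \<le>o s)" by blast
  from someI_ex[OF this] show ?thesis using assms unfolding fip_def by blast
qed

lemma positive_FIP_extend_below_fip:
  assumes \<A>: "positive_FIP J \<A>" and small: "|\<A>| <o fip I J F" and "f \<in> F"
  shows "\<exists>B\<in>I. positive_FIP J (insert (f -` B) \<A>)"
proof (rule ccontr)
  assume "\<not> ?thesis"
  then have "|(\<lambda>A. {A}) ` \<A>| \<in> fip_cardinals I J F"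
    using \<A> \<open>f \<in> F\<close> unfolding fip_cardinals_def by auto
  then have "fip I J F \<le>o |(\<lambda>A. {A}) ` \<A>|" by (rule fip_lower_bound)
  then have "fip I J F \<le>o |\<A>|" using card_of_image ordLeq_transitive by blast
  then show False using small not_ordLess_ordLeq by blast
qed

section \<open>The transfinite recursion\<close>

lemma linear_order_finite_has_greatest:
  assumes "linear_order_on A r" and "finite S" and "S \<noteq> {}" and "S \<subseteq> A"
  shows "\<exists>m\<in>S. S \<subseteq> insert m (underS r m)"
  using assms(2-4)
proof (induction S rule: finite_ne_induct)
  case (singleton x)
  then show ?case by blast
next
  case (insert x S)
  then obtain m where m: "m \<in> S" "S \<subseteq> insert m (underS r m)" by blast
  have tr: "trans r" and tot: "total_on A r"
    using assms(1) by (simp_all add: linear_order_on_def partial_order_on_def preorder_on_def)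
  have "x \<in> A" "m \<in> A" "x \<noteq> m" using insert.hyps insert.prems m(1) by auto
  then have "(x, m) \<in> r \<or> (m, x) \<in> r" using tot by (simp add: total_on_def)
  then consider "(x, m) \<in> r" | "(m, x) \<in> r" by blast
  then show ?case
  proof cases
    case 1
    then have "insert x S \<subseteq> insert m (underS r m)" using m unfolding underS_def by blast
    then show ?thesis using m(1) by blast
  next
    case 2
    then have "insert x S \<subseteq> insert x (underS r x)"
      using m(2) transD[OF tr] unfolding underS_def by blast
    then show ?thesis by blast
  qed
qed

text \<open>
  The family built before stage \<open>f\<close>: the preimages \<open>h -` B h\<close> over the predecessors \<open>h\<close> of \<open>f\<close>.
  The recursion starts from \<open>{UNIV}\<close>, which is dropped as soon as \<open>f\<close> has a predecessor. In this
  way the family at stage \<open>f\<close> has at most \<open>max 1 |underS ( |F| ) f|\<close> members, fewer than \<open>|F|\<close>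
  even for finite \<open>F\<close> with at least two members. Only for a one-element \<open>F\<close> is strictness of
  the inequality with \<open>fip I J F\<close> needed.
\<close>

definition earlier_preimages ::
    "(nat \<Rightarrow> nat) set \<Rightarrow> ((nat \<Rightarrow> nat) \<Rightarrow> nat set) \<Rightarrow> (nat \<Rightarrow> nat) \<Rightarrow> nat set set" where
  "earlier_preimages F B f =
     (if underS ( |F| ) f = {} then {UNIV} else (\<lambda>h. h -` B h) ` underS ( |F| ) f)"

text \<open>The family of preimages over any nonempty \<open>S \<subseteq> F\<close> inherits \<open>J\<^sup>+\<close>-FIP from the stages in \<open>S\<close>:
  a finite subfamily already lies in the stage of its greatest index.\<close>

lemma positive_FIP_preimages:
  assumes "S \<subseteq> F" and "S \<noteq> {}"
    and stage: "\<And>h. h \<in> S \<Longrightarrow> positive_FIP J (insert (h -` B h) (earlier_preimages F B h))"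
  shows "positive_FIP J ((\<lambda>h. h -` B h) ` S)"
proof (rule positive_FIP_finitary)
  show "(\<lambda>h. h -` B h) ` S \<noteq> {}" using \<open>S \<noteq> {}\<close> by blast
  fix G assume "finite G" "G \<subseteq> (\<lambda>h. h -` B h) ` S"
  then obtain T where T: "finite T" "T \<subseteq> S" "G = (\<lambda>h. h -` B h) ` T"
    by (meson finite_subset_image)
  have lin: "linear_order_on F |F|"
    using card_of_well_order_on unfolding well_order_on_def by blast
  show "\<exists>\<D>. positive_FIP J \<D> \<and> G \<subseteq> \<D>"
  proof (cases "T = {}")
    case True
    then show ?thesis using T stage \<open>S \<noteq> {}\<close> by blast
  next
    case False
    then obtain m where m: "m \<in> T" "T \<subseteq> insert m (underS ( |F| ) m)"
      using linear_order_finite_has_greatest[OF lin T(1)] T(2) \<open>S \<subseteq> F\<close> by blast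
    then have "G \<subseteq> insert (m -` B m) (earlier_preimages F B m)"
      unfolding T(3) earlier_preimages_def by auto
    then show ?thesis using stage m(1) T(2) by blast
  qed
qed

lemma earlier_preimages_below_fip:
  assumes le: "|F| \<le>o fip I J F"
    and strict: "is_singleton F \<longrightarrow> |F| <o fip I J F"
    and "f \<in> F"
  shows "|earlier_preimages F B f| <o fip I J F"
proof (cases "underS ( |F| ) f = {}")
  case True
  show ?thesis
  proof (cases "is_singleton F")
    case True
    then have "|F| <o fip I J F" using strict by simp
    moreover have "|{UNIV :: nat set}| \<le>o |F|"
      using \<open>f \<in> F\<close> by (intro card_of_singl_ordLeq) auto
    ultimately have "|{UNIV :: nat set}| <o fip I J F" by (rule ordLeq_ordLess_trans[rotated])
    then show ?thesis using \<open>underS ( |F| ) f = {}\<close> by (simp add: earlier_preimages_def)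
  next
    case False
    obtain h where "h \<in> F" "h \<noteq> f"
      using False \<open>f \<in> F\<close> is_singletonI'[of F] by blast
    then have "\<not> (\<exists>g. inj_on g F \<and> g ` F \<subseteq> {UNIV :: nat set})"
      using \<open>f \<in> F\<close> unfolding inj_on_def image_subset_iff by (metis singletonD)
    then have "|{UNIV :: nat set}| <o |F|" by (simp only: card_of_ordLess)
    then show ?thesis
      using True ordLess_ordLeq_trans[OF _ le] by (simp add: earlier_preimages_def)
  qed
next
  case False
  have "|underS ( |F| ) f| <o |F|"
    using card_of_underS[OF card_of_Card_order] \<open>f \<in> F\<close> by (simp add: Field_card_of)
  then have "|(\<lambda>h. h -` B h) ` underS ( |F| ) f| <o fip I J F"
    by (rule ordLeq_ordLess_trans[OF card_of_image ordLess_ordLeq_trans[OF _ le]])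
  then show ?thesis using False by (simp add: earlier_preimages_def)
qed

lemma exists_positive_preimages:
  assumes J: "ideal_on_omega J"
    and le: "|F| \<le>o fip I J F"
    and strict: "is_singleton F \<longrightarrow> |F| <o fip I J F"
    and "F \<noteq> {}"
  obtains B where "\<And>f. f \<in> F \<Longrightarrow> B f \<in> I" and "positive_FIP J ((\<lambda>f. f -` B f) ` F)"
proof -
  let ?P = "\<lambda>B f X. f \<in> F \<longrightarrow>
    X \<in> I \<and> positive_FIP J (insert (f -` X) (earlier_preimages F B f))"
  have "\<exists>B. \<forall>f. ?P B f (B f)"
  proof (rule dependent_wf_choice)
    show "wf ( |F| - Id)"
      using card_of_well_order_on unfolding well_order_on_def by blast
  next
    fix B B' :: "(nat \<Rightarrow> nat) \<Rightarrow> nat set" and f X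
    assume "\<And>h. (h, f) \<in> |F| - Id \<Longrightarrow> B h = B' h"
    then have "earlier_preimages F B f = earlier_preimages F B' f"
      unfolding earlier_preimages_def underS_def by (auto intro!: image_cong)
    then show "?P B f X = ?P B' f X" by simp
  next
    fix f B
    assume IH: "\<And>h. (h, f) \<in> |F| - Id \<Longrightarrow> ?P B h (B h)"
    have sub: "underS ( |F| ) f \<subseteq> F" using Field_card_of[of F] unfolding underS_def Field_def by blast
    have "positive_FIP J (earlier_preimages F B f)"
    proof (cases "underS ( |F| ) f = {}")
      case True
      then show ?thesis using positive_FIP_singleton_UNIV[OF J] by (simp add: earlier_preimages_def)
    next
      case False
      have "positive_FIP J (insert (h -` B h) (earlier_preimages F B h))"
        if "h \<in> underS ( |F| ) f" for h
        using IH[of h] that sub unfolding underS_def by blast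
      then show ?thesis
        using positive_FIP_preimages[OF sub False] False by (simp add: earlier_preimages_def)
    qed
    then show "\<exists>X. ?P B f X"
      using positive_FIP_extend_below_fip earlier_preimages_below_fip[OF le strict] by metis
  qed
  then obtain B where B: "\<And>f. ?P B f (B f)" by blast
  have "positive_FIP J ((\<lambda>f. f -` B f) ` F)"
    using positive_FIP_preimages[of F F] \<open>F \<noteq> {}\<close> B by blast
  then show ?thesis using B that by blast
qed

section \<open>The ultrafilter\<close>

lemma not_in_dual_ideal:
  assumes "ultrafilter_on_omega U" and "A \<in> U"
  shows "A \<notin> dual_ideal U"
proof
  assume "A \<in> dual_ideal U"
  then have "- A \<in> U" by (auto simp: dual_ideal_def)
  moreover have "\<forall>A\<in>U. \<forall>B\<in>U. A \<inter> B \<in> U" using assms(1) by (simp add: ultrafilter_on_omega_def)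
  ultimately have "A \<inter> - A \<in> U" using \<open>A \<in> U\<close> by (simp only: Ball_def)
  then show False using assms(1) by (simp add: ultrafilter_on_omega_def)
qed

lemma exists_ultrafilter_not_ideal_le:
  assumes J: "ideal_on_omega J"
    and le: "|F| \<le>o fip I J F"
    and strict: "is_singleton F \<longrightarrow> |F| <o fip I J F"
  shows "\<exists>U. ultrafilter_on_omega U \<and> \<not> ideal_le F I (dual_ideal U) \<and> J \<subseteq> dual_ideal U"
proof (cases "F = {}")
  case True
  then show ?thesis
    using exists_ultrafilter_extending[OF J positive_FIP_singleton_UNIV[OF J]]
    by (metis ideal_le_def empty_iff)
next
  case False
  obtain B where B: "\<And>f. f \<in> F \<Longrightarrow> B f \<in> I" and FIP: "positive_FIP J ((\<lambda>f. f -` B f) ` F)"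
    using exists_positive_preimages[OF J le strict False] by blast
  obtain U where U: "ultrafilter_on_omega U" "(\<lambda>f. f -` B f) ` F \<subseteq> U" "J \<subseteq> dual_ideal U"
    using exists_ultrafilter_extending[OF J FIP] by blast
  have "f -` B f \<notin> dual_ideal U" if "f \<in> F" for f
    using not_in_dual_ideal[OF U(1)] U(2) that by blast
  then have "\<not> ideal_le F I (dual_ideal U)" using B unfolding ideal_le_def by blast
  then show ?thesis using U by blast
qed

lemma not_I_point_if_subset_dual_ideal:
  assumes "J \<subseteq> dual_ideal U"
  shows "\<not> I_point J U"
proof -
  have "ideal_le {f. inj f} J (dual_ideal U)"
    unfolding ideal_le_def using assms by (intro bexI[of _ id]) auto
  then show ?thesis by (simp add: I_point_def)
qed

theorem theorem3p2:
  fixes I J :: "nat set set" and F :: "(nat \<Rightarrow> nat) set"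
  assumes "ideal_on_omega I" and "ideal_on_omega J"
    and "|F| \<le>o fip I J F"
    and "is_singleton F \<longrightarrow> |F| <o fip I J F"
  shows "(\<exists>U. ultrafilter_on_omega U \<and> \<not> ideal_le F I (dual_ideal U) \<and> J \<subseteq> dual_ideal U)
    \<and> (F = UNIV \<longrightarrow> (\<exists>U. I_ultrafilter I U \<and> \<not> I_point J U))
    \<and> (F = {f. finite_to_one f} \<longrightarrow> (\<exists>U. weak_I_ultrafilter I U \<and> \<not> I_point J U))
    \<and> (F = {f. inj f} \<longrightarrow> (\<exists>U. I_point I U \<and> \<not> I_point J U))"
proof -
  obtain U where U: "ultrafilter_on_omega U" "\<not> ideal_le F I (dual_ideal U)" "J \<subseteq> dual_ideal U"
    using exists_ultrafilter_not_ideal_le[OF assms(2-4)] by blast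
  have "\<not> I_point J U" using not_I_point_if_subset_dual_ideal[OF U(3)] .
  with U show ?thesis
    unfolding I_ultrafilter_def weak_I_ultrafilter_def I_point_def[of I] by blast
qed

end
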